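(* Let $a$ be an integer (negative, zero or positive), let $n$ be a non-negative integer, and let $k$ and $\ell$ be real numbers. Then $$\sum_{\substack{i+j=n\\ i,j\ge 0}}\binom{a\,i+k-\ell}{i}\binom{a\,j+\ell}{j} =\sum_{\substack{i+j=n\\ i,j\ge 0}}\binom{a\,i+k}{i}\binom{a\,j}{j} =\sum_{i=0}^n (a-1)^{n-i}\binom{a\,n+k+1}{i} =\sum_{i=0}^n a^{n-i}\binom{(a-1)n+k+i}{i},$$ where we take $0^0=1$.
   Context: For a real number $x$ and a non-negative integer $m$, $\binom{x}{m}=\frac{x(x-1)\cdots(x-m+1)}{m!}$, with $\binom{x}{0}=1$. Sums over $i+j=n$ range over all pairs $(i,j)$ of non-negative integers with $i+j=n$. *)

theory Defs
  imports Complex_Main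
begin

end

theory Submission
  imports Defs "HOL-Computational_Algebra.Polynomial"
begin

text \<open>All sums are polynomials in \<open>k\<close>, and Pascal's rule shows that each of them satisfies the
  difference equation \<open>U\<^sub>n\<^sub>+\<^sub>1(x + 1) - U\<^sub>n\<^sub>+\<^sub>1(x) = U\<^sub>n(x + a)\<close>. A polynomial of period \<open>1\<close> is
  constant, so by induction on \<open>n\<close> two solutions agree as soon as they agree at one point for each
  \<open>n\<close>. The two closed forms are compared at \<open>k = - (a - 1) n - 1\<close>, where they reduce to the binomial
  theorem. The convolution and the first closed form are compared at \<open>k = - a n - 1\<close>, where the
  convolution is the \<open>n\<close>-th finite difference of a polynomial of degree \<open>n\<close>. That the convolution
  does not depend on \<open>\<ell>\<close> follows in the same way, since shifting either argument gives the
  same difference.\<close>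

section \<open>Periodic polynomials and finite differences\<close>

text \<open>The value \<open>f y\<close> is taken at all points \<open>y + real m\<close>, so the
  polynomial minus this constant has infinitely many roots.\<close>

lemma periodic_poly_const:
  fixes f :: "real \<Rightarrow> real"
  assumes "f \<in> range poly" and per: "\<And>x. f (x + 1) = f x"
  shows "f x = f y"
proof -
  obtain p where p: "f = poly p" using assms(1) by blast
  have shift: "f (y + real m) = f y" for m
    using per[of "y + real _"] by (induction m) (simp_all add: ac_simps)
  have "range (\<lambda>m. y + real m) \<subseteq> {z. poly (p - [:f y:]) z = 0}"
    using shift p by auto
  moreover have "infinite (range (\<lambda>m. y + real m))"
    by (rule range_inj_infinite) (simp add: inj_def)
  ultimately have "p - [:f y:] = 0"
    using poly_roots_finite finite_subset by blast
  then have "poly (p - [:f y:]) x = 0" by (simp only: poly_0)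
  then show ?thesis by (simp add: p)
qed

lemma gbinomial_affine_poly:
  "((u * x + v) gchoose i) =
     poly (smult (1 / fact i) (\<Prod>m = 0..<i. [:v - real m, u:])) (x::real)"
  by (simp add: gbinomial_prod_rev poly_prod algebra_simps)

lemma difference_equation_unique:
  fixes U V :: "nat \<Rightarrow> real \<Rightarrow> real"
  assumes poly: "\<And>n. U n \<in> range poly" "\<And>n. V n \<in> range poly"
    and zero: "\<And>x. U 0 x = V 0 x"
    and U: "\<And>n x. U (Suc n) (x + 1) = U (Suc n) x + U n (x + a)"
    and V: "\<And>n x. V (Suc n) (x + 1) = V (Suc n) x + V n (x + a)"
    and pt: "\<And>n. U n (c n) = V n (c n)"
  shows "U n x = V n x"
proof (induction n arbitrary: x)
  case (Suc n)
  obtain p q where "U (Suc n) = poly p" "V (Suc n) = poly q" using poly by blast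
  then have "(\<lambda>x. U (Suc n) x - V (Suc n) x) = poly (p - q)" by auto
  then have "(\<lambda>x. U (Suc n) x - V (Suc n) x) \<in> range poly" by blast
  then have "U (Suc n) x - V (Suc n) x = U (Suc n) (c (Suc n)) - V (Suc n) (c (Suc n))"
    by (rule periodic_poly_const) (simp add: U V Suc.IH)
  then show ?case using pt by simp
qed (rule zero)

text \<open>An \<open>n\<close>-th finite difference annihilates degree below \<open>n\<close> and
  picks out the leading coefficient, here \<open>b ^ n\<close>, in degree \<open>n\<close>. The
  induction splits off one factor; since it shifts \<open>j\<close>, the offsets \<open>c\<close>
  must stay arbitrary.\<close>

lemma alternating_sum_prod_affine:
  fixes b :: real and c :: "nat \<Rightarrow> real"
  assumes "m \<le> n"
  shows "(\<Sum>j\<le>n. (-1) ^ j * real (n choose j) * (\<Prod>i<m. b * real j + c i)) =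
    (if m = n then (- b) ^ n * fact n else 0)"
  using assms
proof (induction m arbitrary: n c)
  case 0
  then show ?case by (simp add: choose_alternating_sum)
next
  case (Suc m)
  then obtain n' where n: "n = Suc n'" and le: "m \<le> n'" by (cases n) auto
  let ?g = "\<lambda>j. \<Prod>i<m. b * real j + c i"
  have "(\<Sum>j\<le>n. (-1) ^ j * real (n choose j) * (\<Prod>i<Suc m. b * real j + c i)) =
     b * (\<Sum>j\<le>n. (-1) ^ j * (real j * real (n choose j)) * ?g j) +
     c m * (\<Sum>j\<le>n. (-1) ^ j * real (n choose j) * ?g j)"
    by (simp add: sum_distrib_left sum.distrib[symmetric] algebra_simps)
  \<comment> \<open>Here \<open>m < n\<close> strictly, so the constant part of the split factor
    contributes nothing.\<close>
  also have "(\<Sum>j\<le>n. (-1) ^ j * real (n choose j) * ?g j) = 0"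
    using Suc.IH[of n c] le n by simp
  also have "(\<Sum>j\<le>n. (-1) ^ j * (real j * real (n choose j)) * ?g j) =
      (\<Sum>j\<le>n'. (-1) ^ Suc j * (real (Suc j) * real (Suc n' choose Suc j)) * ?g (Suc j))"
    unfolding n by (subst sum.atMost_Suc_shift) simp
  \<comment> \<open>Absorption lowers \<open>n\<close>, and replacing \<open>j\<close> by
    \<open>Suc j\<close> turns each offset \<open>c i\<close> into \<open>b + c i\<close>.\<close>
  also have "\<dots> = - real n * (\<Sum>j\<le>n'. (-1) ^ j * real (n' choose j) * (\<Prod>i<m. b * real j + (b + c i)))"
  proof -
    have "real (Suc j) * real (Suc n' choose Suc j) = real n * real (n' choose j)" for j
      unfolding n of_nat_mult[symmetric] by (simp only: Suc_times_binomial)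
    then show ?thesis
      by (simp add: sum_distrib_left algebra_simps del: binomial_Suc_Suc of_nat_Suc)
         (simp add: algebra_simps)
  qed
  also have "(\<Sum>j\<le>n'. (-1) ^ j * real (n' choose j) * (\<Prod>i<m. b * real j + (b + c i))) =
      (if m = n' then (- b) ^ n' * fact n' else 0)"
    by (rule Suc.IH[OF le])
  also have "b * (- real n * (if m = n' then (- b) ^ n' * fact n' else 0)) + c m * 0 =
      (if Suc m = n then (- b) ^ n * fact n else 0)"
    by (simp add: n algebra_simps)
  finally show ?case .
qed

text \<open>As a polynomial in \<open>j\<close>, the generalized binomial has degree at most
  \<open>n\<close> and coefficient \<open>b ^ n / fact n\<close> at \<open>j ^ n\<close>.\<close>

lemma alternating_sum_gbinomial_affine:
  fixes b c :: real
  shows "(\<Sum>j\<le>n. (-1) ^ (n - j) * real (n choose j) * ((b * real j + c) gchoose n)) = b ^ n"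
proof -
  have "(-1) ^ (n - j) * real (n choose j) * ((b * real j + c) gchoose n) =
     (-1) ^ n / fact n * ((-1) ^ j * real (n choose j) * (\<Prod>i<n. b * real j + (c - real i)))"
    if "j \<le> n" for j
    using that
    by (auto simp: gbinomial_prod_rev atLeast0LessThan add_diff_eq minus_one_power_iff)
  then have "(\<Sum>j\<le>n. (-1) ^ (n - j) * real (n choose j) * ((b * real j + c) gchoose n)) =
     (-1) ^ n / fact n *
     (\<Sum>j\<le>n. (-1) ^ j * real (n choose j) * (\<Prod>i<n. b * real j + (c - real i)))"
    by (simp add: sum_distrib_left)
  also have "\<dots> = b ^ n"
    by (subst alternating_sum_prod_affine) (simp_all flip: power_mult_distrib)
  finally show ?thesis .
qed

section \<open>The convolution\<close>

definition gbinomial_conv :: "real \<Rightarrow> nat \<Rightarrow> real \<Rightarrow> real \<Rightarrow> real" where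
  "gbinomial_conv a n x y =
     (\<Sum>i\<le>n. ((a * real i + x) gchoose i) * ((a * real (n - i) + y) gchoose (n - i)))"

lemma sum_pairs_eq_gbinomial_conv:
  "(\<Sum>(i, j)\<in>{(i, j). i + j = n}.
      ((a * real i + x) gchoose i) * ((a * real j + y) gchoose j)) = gbinomial_conv a n x y"
  unfolding gbinomial_conv_def
  by (rule sum.reindex_bij_witness[where i = "\<lambda>i. (i, n - i)" and j = fst]) auto

lemma gbinomial_conv_commute: "gbinomial_conv a n x y = gbinomial_conv a n y x"
  unfolding gbinomial_conv_def
  by (rule sum.reindex_bij_witness[where i = "\<lambda>i. n - i" and j = "\<lambda>i. n - i"]) (auto simp: mult.commute)

text \<open>Both slopes are free so as to cover the path \<open>(x - t, t)\<close> as well as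
  \<open>(t, 0)\<close>.\<close>

lemma gbinomial_conv_poly: "(\<lambda>t. gbinomial_conv a n (u * t + x) (v * t + y)) \<in> range poly"
proof -
  define P where "P u x i = smult (1 / fact i) (\<Prod>m = 0..<i. [:x - real m, u:])" for u x :: real and i
  have P: "poly (P u x i) t = (u * t + x) gchoose i" for u x t :: real and i
    unfolding P_def by (rule gbinomial_affine_poly[symmetric])
  have "(\<lambda>t. gbinomial_conv a n (u * t + x) (v * t + y)) =
     poly (\<Sum>i\<le>n. P u (a * real i + x) i * P v (a * real (n - i) + y) (n - i))"
    by (simp add: fun_eq_iff gbinomial_conv_def poly_sum P ac_simps)
  then show ?thesis by blast
qed

text \<open>Pascal's rule applies to the terms with positive index; the increment \<open>a\<close>
  arises from \<open>a * real (Suc i) + x = a * real i + (x + a)\<close>.\<close>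

lemma gbinomial_conv_shift_left:
  "gbinomial_conv a (Suc n) (x + 1) y = gbinomial_conv a (Suc n) x y + gbinomial_conv a n (x + a) y"
proof -
  have eq: "(a * real (Suc i) + (x + 1)) gchoose Suc i =
     ((a * real (Suc i) + x) gchoose Suc i) + ((a * real i + (x + a)) gchoose i)" for i
    using gbinomial_Suc_Suc[of "a * real (Suc i) + x" i] by (simp add: algebra_simps)
  show ?thesis
    unfolding gbinomial_conv_def
    by (simp only: sum.atMost_Suc_shift eq distrib_right sum.distrib diff_Suc_Suc gbinomial_0)
qed

lemma gbinomial_conv_shift_right:
  "gbinomial_conv a (Suc n) x (y + 1) = gbinomial_conv a (Suc n) x y + gbinomial_conv a n x (y + a)"
  using gbinomial_conv_shift_left[of a n y x] by (simp add: gbinomial_conv_commute)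

lemma gbinomial_conv_transfer: "gbinomial_conv a n (x - y) y = gbinomial_conv a n x 0"
proof (induction n arbitrary: x y)
  case 0
  show ?case by (simp add: gbinomial_conv_def)
next
  case (Suc n)
  \<comment> \<open>Both sides are one unit shift away from the pair
    \<open>(x - (t + 1), t)\<close>. The two lower-order terms have arguments with the same sum
    \<open>x - 1 + a\<close>, so they agree by the induction hypothesis.\<close>
  have "gbinomial_conv a (Suc n) (x - (t + 1)) (t + 1) = gbinomial_conv a (Suc n) (x - t) t" for t
    using gbinomial_conv_shift_left[of a n "x - (t + 1)" t]
      gbinomial_conv_shift_right[of a n "x - (t + 1)" t]
      Suc.IH[of "x - 1 + a" t] Suc.IH[of "x - 1 + a" "t + a"]
    by (simp add: algebra_simps)
  moreover have "(\<lambda>t. gbinomial_conv a (Suc n) (x - t) t) \<in> range poly"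
    using gbinomial_conv_poly[of a "Suc n" "-1" x 1 0] by simp
  ultimately show ?case
    using periodic_poly_const[of "\<lambda>t. gbinomial_conv a (Suc n) (x - t) t" y 0] by simp
qed

lemma gbinomial_conv_at_point: "gbinomial_conv a n (- a * real n - 1) 0 = (a - 1) ^ n"
proof -
  have "((a * real j + 0) gchoose j) * ((a * real (n - j) + (- a * real n - 1)) gchoose (n - j)) =
     (-1) ^ (n - j) * real (n choose j) * (((a - 1) * real j + real n) gchoose n)"
    if "j \<le> n" for j
  proof -
    let ?z = "(a - 1) * real j + real n"
    have "((a * real (n - j) + (- a * real n - 1)) gchoose (n - j)) =
        (- (a * real j + 1)) gchoose (n - j)"
      using that by (simp add: of_nat_diff algebra_simps)
    \<comment> \<open>Upper negation: \<open>a * j + 1 + (n - j) - 1\<close> is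
      \<open>?z\<close>.\<close>
    also have "\<dots> = (-1) ^ (n - j) * (?z gchoose (n - j))"
      using that by (subst gbinomial_minus) (simp add: of_nat_diff algebra_simps)
    finally have 1: "((a * real (n - j) + (- a * real n - 1)) gchoose (n - j)) =
        (-1) ^ (n - j) * (?z gchoose (n - j))" .
    \<comment> \<open>Trinomial revision fuses the two factors, leaving \<open>n\<close> as the only
      lower index, so that the sum over \<open>j\<close> becomes an \<open>n\<close>-th finite
      difference.\<close>
    have "(?z gchoose n) * (real n gchoose (n - j)) =
        (?z gchoose (n - j)) * ((?z - real (n - j)) gchoose (n - (n - j)))"
      by (rule gbinomial_trinomial_revision) simp
    moreover have "?z - real (n - j) = a * real j + 0"
      using that by (simp add: of_nat_diff algebra_simps)
    moreover have "real n gchoose (n - j) = real (n choose j)"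
      using that by (simp add: binomial_gbinomial[symmetric] binomial_symmetric[symmetric])
    ultimately show ?thesis
      using that 1 by (simp add: mult_ac)
  qed
  then have "gbinomial_conv a n 0 (- a * real n - 1) =
     (\<Sum>j\<le>n. (-1) ^ (n - j) * real (n choose j) * (((a - 1) * real j + real n) gchoose n))"
    by (simp add: gbinomial_conv_def)
  then show ?thesis
    by (simp add: alternating_sum_gbinomial_affine gbinomial_conv_commute)
qed

section \<open>The closed forms\<close>

definition gbinomial_power_sum :: "real \<Rightarrow> nat \<Rightarrow> real \<Rightarrow> real" where
  "gbinomial_power_sum a n x = (\<Sum>i\<le>n. (a - 1) ^ (n - i) * ((a * real n + x + 1) gchoose i))"

definition gbinomial_power_sum_diag :: "real \<Rightarrow> nat \<Rightarrow> real \<Rightarrow> real" where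
  "gbinomial_power_sum_diag a n x =
     (\<Sum>i\<le>n. a ^ (n - i) * (((a - 1) * real n + x + real i) gchoose i))"

lemma weighted_gbinomial_sum_poly:
  fixes w d :: "nat \<Rightarrow> real"
  shows "(\<lambda>x. \<Sum>i\<le>n. w i * ((x + d i) gchoose i)) \<in> range poly"
proof -
  have "(\<lambda>x. \<Sum>i\<le>n. w i * ((x + d i) gchoose i)) =
    poly (\<Sum>i\<le>n. smult (w i) (smult (1 / fact i) (\<Prod>m = 0..<i. [:d i - real m, 1:])))"
    using gbinomial_affine_poly[of 1] by (simp add: fun_eq_iff poly_sum)
  then show ?thesis by blast
qed

lemma gbinomial_power_sum_poly: "gbinomial_power_sum a n \<in> range poly"
proof -
  have "gbinomial_power_sum a n =
      (\<lambda>x. \<Sum>i\<le>n. (a - 1) ^ (n - i) * ((x + (a * real n + 1)) gchoose i))"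
    by (simp add: fun_eq_iff gbinomial_power_sum_def ac_simps)
  then show ?thesis by (simp only: weighted_gbinomial_sum_poly)
qed

lemma gbinomial_power_sum_diag_poly: "gbinomial_power_sum_diag a n \<in> range poly"
proof -
  have "gbinomial_power_sum_diag a n =
      (\<lambda>x. \<Sum>i\<le>n. a ^ (n - i) * ((x + ((a - 1) * real n + real i)) gchoose i))"
    by (simp add: fun_eq_iff gbinomial_power_sum_diag_def ac_simps)
  then show ?thesis by (simp only: weighted_gbinomial_sum_poly)
qed

lemma gbinomial_power_sum_shift:
  "gbinomial_power_sum a (Suc n) (x + 1) =
     gbinomial_power_sum a (Suc n) x + gbinomial_power_sum a n (x + a)"
proof -
  have eq: "(a * real (Suc n) + (x + 1) + 1) gchoose Suc i =
     ((a * real (Suc n) + x + 1) gchoose Suc i) + ((a * real n + (x + a) + 1) gchoose i)" for i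
    using gbinomial_Suc_Suc[of "a * real (Suc n) + x + 1" i] by (simp add: algebra_simps)
  show ?thesis
    unfolding gbinomial_power_sum_def
    by (simp only: sum.atMost_Suc_shift eq distrib_left sum.distrib diff_Suc_Suc gbinomial_0)
qed

text \<open>In Pascal's rule the unit lost from \<open>real (Suc i)\<close> cancels the
  \<open>-1\<close> in \<open>a - 1\<close>, so the shift is again by \<open>a\<close>.\<close>

lemma gbinomial_power_sum_diag_shift:
  "gbinomial_power_sum_diag a (Suc n) (x + 1) =
     gbinomial_power_sum_diag a (Suc n) x + gbinomial_power_sum_diag a n (x + a)"
proof -
  have eq: "((a - 1) * real (Suc n) + (x + 1) + real (Suc i)) gchoose Suc i =
     (((a - 1) * real (Suc n) + x + real (Suc i)) gchoose Suc i) +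
     (((a - 1) * real n + (x + a) + real i) gchoose i)" for i
    using gbinomial_Suc_Suc[of "(a - 1) * real (Suc n) + x + real (Suc i)" i]
    by (simp add: algebra_simps)
  show ?thesis
    unfolding gbinomial_power_sum_diag_def
    by (simp only: sum.atMost_Suc_shift eq distrib_left sum.distrib diff_Suc_Suc gbinomial_0)
qed

lemma gbinomial_conv_eq_power_sum: "gbinomial_conv a n x 0 = gbinomial_power_sum a n x"
proof (rule difference_equation_unique[where a = a and c = "\<lambda>n. - a * real n - 1"
      and U = "\<lambda>n x. gbinomial_conv a n x 0" and V = "gbinomial_power_sum a"])
  show "(\<lambda>x. gbinomial_conv a n x 0) \<in> range poly" for n
    using gbinomial_conv_poly[of a n 1 0 0 0] by simp
  \<comment> \<open>The upper argument of the power sum is \<open>0\<close> here, so only the term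
    \<open>i = 0\<close> survives.\<close>
  show "gbinomial_conv a n (- a * real n - 1) 0 = gbinomial_power_sum a n (- a * real n - 1)" for n
    unfolding gbinomial_conv_at_point gbinomial_power_sum_def
    by (simp add: gbinomial_0_left if_distrib[of "(*) _"] sum.delta cong: if_cong)
qed (simp_all only: gbinomial_power_sum_poly gbinomial_conv_shift_left gbinomial_power_sum_shift,
     simp add: gbinomial_conv_def gbinomial_power_sum_def)

lemma gbinomial_power_sum_eq_diag: "gbinomial_power_sum a n x = gbinomial_power_sum_diag a n x"
proof (rule difference_equation_unique[where a = a and c = "\<lambda>n. - (a - 1) * real n - 1"
      and U = "gbinomial_power_sum a" and V = "gbinomial_power_sum_diag a"])
  show "gbinomial_power_sum a n (- (a - 1) * real n - 1) =
      gbinomial_power_sum_diag a n (- (a - 1) * real n - 1)" for n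
  proof -
    \<comment> \<open>The upper argument becomes \<open>n\<close>, which gives the binomial
      expansion of \<open>(1 + (a - 1)) ^ n\<close>.\<close>
    have "gbinomial_power_sum a n (- (a - 1) * real n - 1) =
        (\<Sum>i\<le>n. real (n choose i) * 1 ^ i * (a - 1) ^ (n - i))"
      by (simp add: gbinomial_power_sum_def binomial_gbinomial algebra_simps)
    also have "\<dots> = a ^ n"
      by (subst binomial_ring[symmetric]) simp
    also have "\<dots> = (\<Sum>i\<le>n. if i = 0 then a ^ n else 0)"
      by simp
    also have "\<dots> = gbinomial_power_sum_diag a n (- (a - 1) * real n - 1)"
      unfolding gbinomial_power_sum_diag_def
    proof (rule sum.cong[OF refl])
      fix i
      \<comment> \<open>At this point the diagonal sum has upper argument \<open>i - 1\<close>, a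
        natural number below \<open>i\<close> unless \<open>i = 0\<close>.\<close>
      have "(real i - 1) gchoose i = 0" if "i \<noteq> 0"
        using that binomial_gbinomial[of "i - 1" i, where 'a = real] by (simp add: of_nat_diff binomial_eq_0)
      then show "(if i = 0 then a ^ n else 0) = a ^ (n - i) *
          (((a - 1) * real n + (- (a - 1) * real n - 1) + real i) gchoose i)"
        by (simp add: algebra_simps)
    qed
    finally show ?thesis .
  qed
  show "gbinomial_power_sum a 0 x = gbinomial_power_sum_diag a 0 x" for x
    by (simp add: gbinomial_power_sum_def gbinomial_power_sum_diag_def)
qed (rule gbinomial_power_sum_poly gbinomial_power_sum_diag_poly
       gbinomial_power_sum_shift gbinomial_power_sum_diag_shift)+

theorem theorem1:
  fixes a :: int and n :: nat and k l :: real
  shows "(\<Sum>(i, j)\<in>{(i, j). i + j = n}.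
             ((of_int a * real i + k - l) gchoose i) * ((of_int a * real j + l) gchoose j))
       = (\<Sum>(i, j)\<in>{(i, j). i + j = n}.
             ((of_int a * real i + k) gchoose i) * ((of_int a * real j) gchoose j))
     \<and> (\<Sum>(i, j)\<in>{(i, j). i + j = n}.
             ((of_int a * real i + k) gchoose i) * ((of_int a * real j) gchoose j))
       = (\<Sum>i=0..n. (of_int a - 1) ^ (n - i) * ((of_int a * real n + k + 1) gchoose i))
     \<and> (\<Sum>i=0..n. (of_int a - 1) ^ (n - i) * ((of_int a * real n + k + 1) gchoose i))
       = (\<Sum>i=0..n. of_int a ^ (n - i) * (((of_int a - 1) * real n + k + real i) gchoose i))"
  using gbinomial_conv_transfer[of "of_int a" n k l] gbinomial_conv_eq_power_sum[of "of_int a" n k]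
    gbinomial_power_sum_eq_diag[of "of_int a" n k]
    sum_pairs_eq_gbinomial_conv[of "of_int a" "k - l" l n] sum_pairs_eq_gbinomial_conv[of "of_int a" k 0 n]
  unfolding gbinomial_power_sum_def gbinomial_power_sum_diag_def atMost_atLeast0
  by (simp add: add_diff_eq)

end
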